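(* Let $n,m,k$ and $u_1,\ldots,u_k$ be positive integers. Suppose that there exists a signed group orthogonal design $SOD(n;\,u_1,\ldots,u_k)$ over some signed group $S$ that is equipped with a remrep $\pi: S\to SP_m$ of degree $m$, where $m$ is the order of a Hadamard matrix. Then there is an orthogonal design $OD(mn;\,mu_1,\ldots,mu_k)$.
   Context: A signed group $S$ is a group with a distinguished central element of order two, denoted $-1$ (the unit is denoted $1$). The signed group ring $\mathbb{R}[S]$ consists of the finite sums $\sum r_i s_i$ with $r_i\in\mathbb{R}$, $s_i\in P$, where $P$ is a set of coset representatives of $S$ modulo $\langle -1\rangle$, with the identification $-rs=r(-s)$; addition is termwise and multiplication is by linear extension (i.e. the distinguished element $-1$ is identified with the scalar $-1$). Conjugation on $\mathbb{R}[S]$ is $\overline{\sum r_i s_i}=\sum r_i s_i^{-1}$. Variables are commuting real indeterminates that commute with elements of $S$ and are fixed by conjugation; for a matrix $A=[a_{ij}]$, $A^*=[\overline{a}_{ji}]$. A signed group orthogonal design $SOD(n;\,u_1,\ldots,u_k)$ over $S$ is a square matrix $X$ of order $n$, each entry of which is $0$ or of the form $\epsilon x_j$ with $\epsilon\in S$, $1\le j\le k$, where $x_1,\ldots,x_k$ are distinct variables, such that $XX^*=\big(\sum_{i=1}^k u_i x_i^2\big)I_n$. An $OD(n;\,u_1,\ldots,u_k)$ (orthogonal design) is an SOD over the trivial signed group $\{1,-1\}$, i.e. with entries from $\{0,\pm x_1,\ldots,\pm x_k\}$. $SP_m$ is the signed group of all monomial $\{0,\pm1\}$-matrices of order $m$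 (exactly one nonzero entry in each row and column), with distinguished element $-I_m$. A signed group homomorphism $\phi:S\to T$ is a group homomorphism with $\phi(-1)=-1$. A remrep (real monomial representation) of degree $m$ of $S$ is a signed group homomorphism $\pi:S\to SP_m$. *)

theory Defs
  imports
    "HOL-Algebra.Coset"
    "HOL-Library.Poly_Mapping"
    "Jordan_Normal_Form.Matrix"
begin

record 'a signed_group = "'a monoid" +
  neg_one :: 'a ("\<^bold>-\<one>\<index>")

locale signed_group = group S for S (structure) +
  assumes neg_one_closed: "\<^bold>-\<one> \<in> carrier S"
    and neg_one_central: "\<And>s. s \<in> carrier S \<Longrightarrow> \<^bold>-\<one> \<otimes> s = s \<otimes> \<^bold>-\<one>"
    and neg_one_neq_one: "\<^bold>-\<one> \<noteq> \<one>"
    and neg_one_square: "\<^bold>-\<one> \<otimes> \<^bold>-\<one> = \<one>"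

definition signed_group_hom ::
  "('a, 'c) signed_group_scheme \<Rightarrow> ('b, 'd) signed_group_scheme \<Rightarrow> ('a \<Rightarrow> 'b) set" where
  "signed_group_hom S T = {h \<in> hom S T. h \<^bold>-\<one>\<^bsub>S\<^esub> = \<^bold>-\<one>\<^bsub>T\<^esub>}"

definition coset_reps :: "('a, 'c) signed_group_scheme \<Rightarrow> 'a set \<Rightarrow> bool" where
  "coset_reps S P \<longleftrightarrow> P \<subseteq> carrier S \<and>
     (\<forall>C \<in> rcosets\<^bsub>S\<^esub> {\<one>\<^bsub>S\<^esub>, \<^bold>-\<one>\<^bsub>S\<^esub>}. \<exists>!p. p \<in> P \<inter> C)"

definition trivial_signed_group :: "int signed_group" where
  "trivial_signed_group = \<lparr>carrier = {1, -1}, monoid.mult = (*), one = 1, neg_one = -1\<rparr>"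

text \<open>Matrices are those of \<^theory>\<open>Jordan_Normal_Form.Matrix\<close>, with indices starting at 0.\<close>

definition monomial_mats :: "nat \<Rightarrow> int mat set" where
  "monomial_mats m = {A \<in> carrier_mat m m.
     (\<forall>i<m. \<forall>j<m. A $$ (i, j) \<in> {0, 1, -1}) \<and>
     (\<forall>i<m. \<exists>!j. j < m \<and> A $$ (i, j) \<noteq> 0) \<and>
     (\<forall>j<m. \<exists>!i. i < m \<and> A $$ (i, j) \<noteq> 0)}"

definition SP :: "nat \<Rightarrow> int mat signed_group" where
  "SP m = \<lparr>carrier = monomial_mats m, monoid.mult = (*), one = 1\<^sub>m m, neg_one = - 1\<^sub>m m\<rparr>"

definition remrep :: "('a, 'c) signed_group_scheme \<Rightarrow> nat \<Rightarrow> ('a \<Rightarrow> int mat) \<Rightarrow> bool" where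
  "remrep S m \<pi> \<longleftrightarrow> \<pi> \<in> signed_group_hom S (SP m)"

definition hadamard :: "nat \<Rightarrow> int mat \<Rightarrow> bool" where
  "hadamard m H \<longleftrightarrow> H \<in> carrier_mat m m \<and>
     (\<forall>i<m. \<forall>j<m. H $$ (i, j) \<in> {1, -1}) \<and>
     H * transpose_mat H = int m \<cdot>\<^sub>m 1\<^sub>m m"

text \<open>Real polynomials in commuting indeterminates indexed by the natural numbers; a monomial
  is the finitely supported map of its exponents.\<close>

type_synonym real_mpoly = "(nat \<Rightarrow>\<^sub>0 nat) \<Rightarrow>\<^sub>0 real"

definition indet :: "nat \<Rightarrow> real_mpoly" where
  "indet j = Poly_Mapping.single (Poly_Mapping.single j 1) 1"

text \<open>Since the variables commute with the elements of \<open>S\<close>, polynomials over \<open>\<real>[S]\<close> are the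
  elements of the signed group ring of \<open>S\<close> with coefficients in the real polynomials: the
  formal sums \<open>\<Sum> r\<^sub>i s\<^sub>i\<close> with \<open>r\<^sub>i\<close> a real polynomial and \<open>s\<^sub>i\<close> in a fixed
  set \<open>P\<close> of coset representatives. They are represented by finitely supported
  maps with keys in \<open>P\<close>, so that addition is the one of \<open>\<Rightarrow>\<^sub>0\<close>. The operations below are
  generic in the coefficient ring.\<close>

text \<open>The element \<open>r s\<close> for arbitrary \<open>s\<close> in \<open>S\<close>: if \<open>s\<close> is not a representative then
  \<open>-s\<close> is, and \<open>r s = (-r) (-s)\<close>.\<close>

definition sgr_term ::
  "('a, 'c) signed_group_scheme \<Rightarrow> 'a set \<Rightarrow> 'r \<Rightarrow> 'a \<Rightarrow> ('a \<Rightarrow>\<^sub>0 'r::comm_ring_1)" where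
  "sgr_term S P r s =
     (if s \<in> P then Poly_Mapping.single s r
      else Poly_Mapping.single (\<^bold>-\<one>\<^bsub>S\<^esub> \<otimes>\<^bsub>S\<^esub> s) (- r))"

definition sgr_mult ::
  "('a, 'c) signed_group_scheme \<Rightarrow> 'a set \<Rightarrow>
   ('a \<Rightarrow>\<^sub>0 'r::comm_ring_1) \<Rightarrow> ('a \<Rightarrow>\<^sub>0 'r) \<Rightarrow> ('a \<Rightarrow>\<^sub>0 'r)" where
  "sgr_mult S P f g =
     (\<Sum>a \<in> Poly_Mapping.keys f. \<Sum>b \<in> Poly_Mapping.keys g.
        sgr_term S P (Poly_Mapping.lookup f a * Poly_Mapping.lookup g b) (a \<otimes>\<^bsub>S\<^esub> b))"

definition sgr_conj ::
  "('a, 'c) signed_group_scheme \<Rightarrow> 'a set \<Rightarrow> ('a \<Rightarrow>\<^sub>0 'r::comm_ring_1) \<Rightarrow> ('a \<Rightarrow>\<^sub>0 'r)" where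
  "sgr_conj S P f =
     (\<Sum>a \<in> Poly_Mapping.keys f. sgr_term S P (Poly_Mapping.lookup f a) (inv\<^bsub>S\<^esub> a))"

definition sgr_mat_mult ::
  "('a, 'c) signed_group_scheme \<Rightarrow> 'a set \<Rightarrow>
   ('a \<Rightarrow>\<^sub>0 'r::comm_ring_1) mat \<Rightarrow> ('a \<Rightarrow>\<^sub>0 'r) mat \<Rightarrow> ('a \<Rightarrow>\<^sub>0 'r) mat" where
  "sgr_mat_mult S P A B = mat (dim_row A) (dim_col B)
     (\<lambda>(i, j). \<Sum>l<dim_col A. sgr_mult S P (A $$ (i, l)) (B $$ (l, j)))"

definition sgr_mat_star ::
  "('a, 'c) signed_group_scheme \<Rightarrow> 'a set \<Rightarrow>
   ('a \<Rightarrow>\<^sub>0 'r::comm_ring_1) mat \<Rightarrow> ('a \<Rightarrow>\<^sub>0 'r) mat" where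
  "sgr_mat_star S P A = mat (dim_col A) (dim_row A) (\<lambda>(i, j). sgr_conj S P (A $$ (j, i)))"

definition sgr_scalar_mat ::
  "('a, 'c) signed_group_scheme \<Rightarrow> 'a set \<Rightarrow> nat \<Rightarrow> 'r \<Rightarrow> ('a \<Rightarrow>\<^sub>0 'r::comm_ring_1) mat" where
  "sgr_scalar_mat S P n r =
     mat n n (\<lambda>(i, j). if i = j then sgr_term S P r \<one>\<^bsub>S\<^esub> else 0)"

definition SOD ::
  "('a, 'c) signed_group_scheme \<Rightarrow> 'a set \<Rightarrow> nat \<Rightarrow> nat \<Rightarrow> (nat \<Rightarrow> nat) \<Rightarrow>
   ('a \<Rightarrow>\<^sub>0 real_mpoly) mat \<Rightarrow> bool" where
  "SOD S P n k u X \<longleftrightarrow> X \<in> carrier_mat n n \<and>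
     (\<forall>i<n. \<forall>j<n. X $$ (i, j) = 0 \<or>
        (\<exists>\<epsilon> \<in> carrier S. \<exists>l \<in> {1..k}. X $$ (i, j) = sgr_term S P (indet l) \<epsilon>)) \<and>
     sgr_mat_mult S P X (sgr_mat_star S P X) =
       sgr_scalar_mat S P n (\<Sum>l = 1..k. of_nat (u l) * (indet l)^2)"

definition OD :: "nat \<Rightarrow> nat \<Rightarrow> (nat \<Rightarrow> nat) \<Rightarrow> (int \<Rightarrow>\<^sub>0 real_mpoly) mat \<Rightarrow> bool" where
  "OD n k u X \<longleftrightarrow> SOD trivial_signed_group {1} n k u X"

lemma signed_group_trivial: "signed_group trivial_signed_group"
proof -
  have "group trivial_signed_group"
    by (rule groupI) (auto simp: trivial_signed_group_def)
  then show ?thesis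
    unfolding signed_group_def signed_group_axioms_def
    by (auto simp: trivial_signed_group_def)
qed

lemma coset_reps_trivial: "coset_reps trivial_signed_group {1}"
  by (auto simp: coset_reps_def trivial_signed_group_def RCOSETS_def r_coset_def)

lemma OD_iff:
  "(\<exists>Y. OD n k u Y) \<longleftrightarrow>
    (\<exists>A \<in> carrier_mat n n.
       (\<forall>i<n. \<forall>j<n. A $$ (i, j) = 0 \<or>
          (\<exists>l \<in> {1..k}. A $$ (i, j) = indet l \<or> A $$ (i, j) = - indet l)) \<and>
       A * transpose_mat A = (\<Sum>l = 1..k. of_nat (u l) * (indet l)^2) \<cdot>\<^sub>m 1\<^sub>m n)"
    (is "_ \<longleftrightarrow> (\<exists>A \<in> carrier_mat n n. ?entries A \<and> A * transpose_mat A = ?q \<cdot>\<^sub>m 1\<^sub>m n)")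
proof -
  let ?T = "trivial_signed_group"
  let ?c = "\<lambda>r :: real_mpoly. Poly_Mapping.single (1::int) r"
  have inv1: "inv\<^bsub>?T\<^esub> 1 = 1"
    using group.is_monoid[OF signed_group.axioms(1)[OF signed_group_trivial]]
      monoid.inv_one[of ?T] by (simp add: trivial_signed_group_def)
  have term1: "sgr_term ?T {1} r 1 = ?c r" for r
    by (simp add: sgr_term_def)
  have termm: "sgr_term ?T {1} r (-1) = ?c (- r)" for r
    by (simp add: sgr_term_def trivial_signed_group_def)
  have conj: "sgr_conj ?T {1} (?c r) = ?c r" for r
    by (cases "r = 0") (simp_all add: sgr_conj_def inv1 term1)
  have mul: "sgr_mult ?T {1} (?c r) (?c s) = ?c (r * s)" for r s
  proof -
    have "1 \<otimes>\<^bsub>?T\<^esub> 1 = 1" by (simp add: trivial_signed_group_def)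
    then show ?thesis
      by (cases "r = 0"; cases "s = 0") (simp_all add: sgr_mult_def term1)
  qed
  have c_sum: "(\<Sum>l\<in>I. ?c (f l)) = ?c (\<Sum>l\<in>I. f l)" for f and I :: "nat set"
    by (induction I rule: infinite_finite_induct) (simp_all add: single_add)
  have c_inj: "?c r = ?c s \<longleftrightarrow> r = s" for r s
    by (metis lookup_single_eq)
  have one: "\<one>\<^bsub>?T\<^esub> = 1" by (simp add: trivial_signed_group_def)
  have prod: "sgr_mat_mult ?T {1} (map_mat ?c A) (sgr_mat_star ?T {1} (map_mat ?c A))
      = map_mat ?c (A * transpose_mat A)" if "A \<in> carrier_mat n n" for A
    using that
    by (intro eq_matI) (auto simp: sgr_mat_mult_def sgr_mat_star_def conj mul c_sum
        scalar_prod_def lessThan_atLeast0)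
  have scal: "sgr_scalar_mat ?T {1} n q = map_mat ?c (q \<cdot>\<^sub>m 1\<^sub>m n)" for q
    by (intro eq_matI) (auto simp: sgr_scalar_mat_def one term1)
  have map_inj: "map_mat ?c A = map_mat ?c B \<longleftrightarrow> A = B"
    if "A \<in> carrier_mat n n" "B \<in> carrier_mat n n" for A B
  proof
    assume eq: "map_mat ?c A = map_mat ?c B"
    show "A = B"
    proof (rule eq_matI)
      fix i j assume ij: "i < dim_row B" "j < dim_col B"
      have "map_mat ?c A $$ (i, j) = map_mat ?c B $$ (i, j)" using eq by simp
      then show "A $$ (i, j) = B $$ (i, j)" using that ij c_inj by auto
    qed (use that in auto)
  qed simp
  have carr: "carrier ?T = {1, -1}" by (simp add: trivial_signed_group_def)
  have entry: "(?c a = 0 \<or> (\<exists>\<epsilon>\<in>carrier ?T. \<exists>l\<in>{1..k}. ?c a = sgr_term ?T {1} (indet l) \<epsilon>))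
      \<longleftrightarrow> (a = 0 \<or> (\<exists>l\<in>{1..k}. a = indet l \<or> a = - indet l))" for a
  proof -
    have "?c a = 0 \<longleftrightarrow> a = 0" using c_inj[of a 0] by simp
    then show ?thesis unfolding carr by (auto simp: term1 termm c_inj)
  qed
  have OD_map: "OD n k u (map_mat ?c A) \<longleftrightarrow>
      ?entries A \<and> A * transpose_mat A = ?q \<cdot>\<^sub>m 1\<^sub>m n" if A: "A \<in> carrier_mat n n" for A
  proof -
    have E: "map_mat ?c A $$ (i, j) = ?c (A $$ (i, j))" if "i < n" "j < n" for i j
      using that A by auto
    have AA: "A * transpose_mat A \<in> carrier_mat n n" using A by auto
    have Q: "?q \<cdot>\<^sub>m 1\<^sub>m n \<in> carrier_mat n n" by auto
    have C: "map_mat ?c A \<in> carrier_mat n n" using A by auto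
    show ?thesis
      unfolding OD_def SOD_def prod[OF A] scal map_inj[OF AA Q]
      using C by (simp add: E entry del: One_nat_def)
  qed
  show ?thesis
  proof
    assume "\<exists>Y. OD n k u Y"
    then obtain Y where Y: "OD n k u Y" ..
    define A where "A = map_mat (\<lambda>f. Poly_Mapping.lookup f 1) Y"
    have Yc: "Y \<in> carrier_mat n n" using Y by (simp add: OD_def SOD_def)
    have ent: "?c (Poly_Mapping.lookup (Y $$ (i, j)) 1) = Y $$ (i, j)"
      if ij: "i < n" "j < n" for i j
    proof -
      have "Y $$ (i, j) = 0 \<or> (\<exists>\<epsilon>\<in>{1, -1}. \<exists>l\<in>{1..k}. Y $$ (i, j) = sgr_term ?T {1} (indet l) \<epsilon>)"
        using Y ij unfolding OD_def SOD_def carr by blast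
      then show ?thesis by (elim disjE bexE insertE emptyE) (simp_all add: term1 termm)
    qed
    have "Y = map_mat ?c A"
      using Yc by (intro eq_matI) (auto simp: A_def ent)
    moreover have "A \<in> carrier_mat n n" using Yc by (simp add: A_def)
    ultimately show "\<exists>A \<in> carrier_mat n n. ?entries A \<and> A * transpose_mat A = ?q \<cdot>\<^sub>m 1\<^sub>m n"
      using OD_map Y by blast
  qed (use OD_map in blast)
qed

end

theory Submission
  imports Defs
begin

text \<open>The remrep extends linearly to a ring homomorphism \<open>\<Phi>\<close> from the signed group ring to
  the matrices of order \<open>m\<close>. Signed permutation matrices are orthogonal, so \<open>\<Phi>\<close> turns
  conjugation into transposition. Replacing each entry \<open>x\<close> of the SOD by the block \<open>\<Phi>(x) H\<close>
  with \<open>H\<close> Hadamard gives entries \<open>0\<close>, \<open>\<plusminus>x\<^sub>l\<close>, since each row of \<open>\<Phi>(\<epsilon>)\<close> selects a single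
  row of \<open>H\<close> up to sign, and the factor \<open>H H\<^sup>T = m I\<close> is central.\<close>

section \<open>Signed permutation matrices\<close>

text \<open>Distinct rows have disjoint supports, because no column holds two nonzero entries; the
  single nonzero entry of a row squares to 1.\<close>

lemma monomial_mats_orthogonal:
  assumes "A \<in> monomial_mats m"
  shows "A * transpose_mat A = 1\<^sub>m m"
proof (rule eq_matI)
  have A: "A \<in> carrier_mat m m"
    and vals: "\<And>i j. i < m \<Longrightarrow> j < m \<Longrightarrow> A $$ (i, j) \<in> {0, 1, -1}"
    and row: "\<And>i. i < m \<Longrightarrow> \<exists>!j. j < m \<and> A $$ (i, j) \<noteq> 0"
    and col: "\<And>j. j < m \<Longrightarrow> \<exists>!i. i < m \<and> A $$ (i, j) \<noteq> 0"
    using assms by (auto simp: monomial_mats_def)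
  fix i j assume "i < dim_row (1\<^sub>m m :: int mat)" "j < dim_col (1\<^sub>m m :: int mat)"
  then have ij: "i < m" "j < m" by auto
  have entry: "(A * transpose_mat A) $$ (i, j) = (\<Sum>l<m. A $$ (i, l) * A $$ (j, l))"
    using A ij by (simp add: scalar_prod_def lessThan_atLeast0)
  show "(A * transpose_mat A) $$ (i, j) = 1\<^sub>m m $$ (i, j)"
  proof (cases "i = j")
    case True
    obtain l where l: "l < m" "A $$ (i, l) \<noteq> 0"
      and uniq: "\<And>l'. l' < m \<Longrightarrow> A $$ (i, l') \<noteq> 0 \<Longrightarrow> l' = l"
      using row[OF ij(1)] by (elim ex1E) blast
    have "(\<Sum>l'<m. A $$ (i, l') * A $$ (i, l')) = (\<Sum>l'\<in>{l}. A $$ (i, l') * A $$ (i, l'))"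
      by (rule sum.mono_neutral_right) (use l in \<open>auto dest: uniq\<close>)
    also have "\<dots> = 1" using vals[OF ij(1) l(1)] l(2) by auto
    finally show ?thesis using True ij entry by simp
  next
    case False
    have "A $$ (i, l) * A $$ (j, l) = 0" if "l < m" for l
    proof -
      have "i = j" if "A $$ (i, l) \<noteq> 0" "A $$ (j, l) \<noteq> 0"
        using col[OF \<open>l < m\<close>] ij that by blast
      then show ?thesis using False by auto
    qed
    then have "(\<Sum>l<m. A $$ (i, l) * A $$ (j, l)) = 0" by (intro sum.neutral) auto
    then show ?thesis using False ij entry by simp
  qed
qed (use assms in \<open>auto simp: monomial_mats_def\<close>)

section \<open>Linear extension to the signed group ring\<close>

text \<open>The entry \<open>(i, j)\<close> of \<Phi>\<open>(f)\<close>. Working with entries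
  instead of matrices lets additivity hold without any dimension conditions.\<close>

definition sgr_rep :: "('a \<Rightarrow> int mat) \<Rightarrow> ('a \<Rightarrow>\<^sub>0 'r::comm_ring_1) \<Rightarrow> nat \<Rightarrow> nat \<Rightarrow> 'r" where
  "sgr_rep \<pi> f i j =
     (\<Sum>s\<in>Poly_Mapping.keys f. Poly_Mapping.lookup f s * of_int (\<pi> s $$ (i, j)))"

lemma sgr_rep_zero [simp]: "sgr_rep \<pi> 0 i j = 0"
  by (simp add: sgr_rep_def)

lemma sgr_rep_single: "sgr_rep \<pi> (Poly_Mapping.single s r) i j = r * of_int (\<pi> s $$ (i, j))"
  by (cases "r = 0") (simp_all add: sgr_rep_def)

lemma sgr_rep_add: "sgr_rep \<pi> (f + g) i j = sgr_rep \<pi> f i j + sgr_rep \<pi> g i j"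
proof -
  let ?K = "Poly_Mapping.keys f \<union> Poly_Mapping.keys g"
  \<comment> \<open>Coefficients may cancel in \<open>f + g\<close>, so its keys can form a proper
    subset of \<open>?K\<close>. All three sums are therefore extended by zero to
    \<open>?K\<close>.\<close>
  have superset: "sgr_rep \<pi> h i j = (\<Sum>s\<in>?K. Poly_Mapping.lookup h s * of_int (\<pi> s $$ (i, j)))"
    if "Poly_Mapping.keys h \<subseteq> ?K" for h
    unfolding sgr_rep_def
    by (rule sum.mono_neutral_left) (use that in \<open>auto simp: in_keys_iff\<close>)
  show ?thesis
    using keys_add[of f g]
    by (simp add: superset lookup_add distrib_right sum.distrib)
qed

lemma sgr_rep_sum: "sgr_rep \<pi> (\<Sum>x\<in>I. f x) i j = (\<Sum>x\<in>I. sgr_rep \<pi> (f x) i j)"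
  by (induction I rule: infinite_finite_induct) (simp_all add: sgr_rep_add)

section \<open>Compatibility with products and conjugation\<close>

locale signed_group_remrep = signed_group S for S (structure) +
  fixes m :: nat and \<pi> :: "'a \<Rightarrow> int mat"
  assumes remrep: "remrep S m \<pi>"
begin

lemma remrep_monomial: "s \<in> carrier S \<Longrightarrow> \<pi> s \<in> monomial_mats m"
  using remrep by (auto simp: remrep_def signed_group_hom_def hom_def SP_def)

lemma remrep_carrier: "s \<in> carrier S \<Longrightarrow> \<pi> s \<in> carrier_mat m m"
  using remrep_monomial by (auto simp: monomial_mats_def)

lemma remrep_mult: "s \<in> carrier S \<Longrightarrow> t \<in> carrier S \<Longrightarrow> \<pi> (s \<otimes> t) = \<pi> s * \<pi> t"
  using remrep by (auto simp: remrep_def signed_group_hom_def hom_def SP_def)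

lemma remrep_neg_one: "\<pi> \<^bold>-\<one> = - 1\<^sub>m m"
  using remrep by (auto simp: remrep_def signed_group_hom_def SP_def)

lemma remrep_one: "\<pi> \<one> = 1\<^sub>m m"
proof -
  \<comment> \<open>Squaring the image of the distinguished element gives the image of the unit,
    without first showing that \<open>SP m\<close> is a group.\<close>
  have "\<pi> \<one> = \<pi> \<^bold>-\<one> * \<pi> \<^bold>-\<one>"
    using remrep_mult[OF neg_one_closed neg_one_closed] by (simp add: neg_one_square)
  then show ?thesis by (simp add: remrep_neg_one)
qed

lemma remrep_neg: "s \<in> carrier S \<Longrightarrow> \<pi> (\<^bold>-\<one> \<otimes> s) = - \<pi> s"
  using remrep_carrier[of s] by (simp add: remrep_mult neg_one_closed remrep_neg_one)

text \<open>\<open>\<pi> (inv s)\<close> is a left inverse of \<open>\<pi> s\<close>, and by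
  orthogonality the transpose is a right inverse, so the two agree.\<close>

lemma remrep_inv:
  assumes s: "s \<in> carrier S"
  shows "\<pi> (inv s) = transpose_mat (\<pi> s)"
proof -
  have "\<pi> (inv s) = \<pi> (inv s) * (\<pi> s * transpose_mat (\<pi> s))"
    using s remrep_carrier[of "inv s"] by (simp add: monomial_mats_orthogonal[OF remrep_monomial])
  also have "\<dots> = (\<pi> (inv s) * \<pi> s) * transpose_mat (\<pi> s)"
    by (rule assoc_mult_mat[symmetric, of _ m m _ m _ m]) (use s remrep_carrier[of s] remrep_carrier[of "inv s"] in auto)
  also have "\<pi> (inv s) * \<pi> s = 1\<^sub>m m"
    using s remrep_mult[of "inv s" s] remrep_one by simp
  finally show ?thesis using s remrep_carrier[of s] by simp
qed

lemma keys_sgr_term: "s \<in> carrier S \<Longrightarrow> Poly_Mapping.keys (sgr_term S P r s) \<subseteq> carrier S"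
  by (auto simp: sgr_term_def neg_one_closed split: if_splits)

text \<open>If \<open>s\<close> lies outside \<open>P\<close>, the term is stored at its negative
  with coefficient \<open>- r\<close>; the two signs cancel because \<open>\<pi>\<close> respects
  negation.\<close>

lemma sgr_rep_term:
  assumes "s \<in> carrier S" "i < m" "j < m"
  shows "sgr_rep \<pi> (sgr_term S P r s) i j = r * of_int (\<pi> s $$ (i, j))"
  using assms remrep_carrier[OF assms(1)] by (auto simp: sgr_term_def sgr_rep_single remrep_neg)

text \<open>By bilinearity this reduces to multiplicativity of \<open>\<pi>\<close> on keys. The two
  exchanges of sums then bring the matrix index \<open>l\<close> outermost.\<close>

lemma sgr_rep_mult:
  assumes f: "Poly_Mapping.keys f \<subseteq> carrier S" and g: "Poly_Mapping.keys g \<subseteq> carrier S"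
    and ij: "i < m" "j < m"
  shows "sgr_rep \<pi> (sgr_mult S P f g) i j = (\<Sum>l<m. sgr_rep \<pi> f i l * sgr_rep \<pi> g l j)"
proof -
  let ?f = "Poly_Mapping.lookup f" and ?g = "Poly_Mapping.lookup g"
  let ?F = "Poly_Mapping.keys f" and ?G = "Poly_Mapping.keys g"
  have prod: "\<pi> (a \<otimes> b) $$ (i, j) = (\<Sum>l<m. \<pi> a $$ (i, l) * \<pi> b $$ (l, j))"
    if "a \<in> ?F" "b \<in> ?G" for a b
  proof -
    have "a \<in> carrier S" "b \<in> carrier S" using that f g by auto
    then show ?thesis
      using ij remrep_carrier[of a] remrep_carrier[of b]
      by (auto simp: remrep_mult scalar_prod_def lessThan_atLeast0)
  qed
  have "sgr_rep \<pi> (sgr_mult S P f g) i j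
      = (\<Sum>a\<in>?F. \<Sum>b\<in>?G. ?f a * ?g b * of_int (\<pi> (a \<otimes> b) $$ (i, j)))"
    unfolding sgr_mult_def sgr_rep_sum
    by (intro sum.cong refl sgr_rep_term) (use f g ij in auto)
  also have "\<dots> = (\<Sum>a\<in>?F. \<Sum>b\<in>?G. \<Sum>l<m.
      (?f a * of_int (\<pi> a $$ (i, l))) * (?g b * of_int (\<pi> b $$ (l, j))))"
    by (intro sum.cong refl) (simp add: prod sum_distrib_left ac_simps)
  also have "\<dots> = (\<Sum>a\<in>?F. \<Sum>l<m. \<Sum>b\<in>?G.
      (?f a * of_int (\<pi> a $$ (i, l))) * (?g b * of_int (\<pi> b $$ (l, j))))"
    by (intro sum.cong refl sum.swap)
  also have "\<dots> = (\<Sum>l<m. \<Sum>a\<in>?F. \<Sum>b\<in>?G.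
      (?f a * of_int (\<pi> a $$ (i, l))) * (?g b * of_int (\<pi> b $$ (l, j))))"
    by (rule sum.swap)
  finally show ?thesis by (simp add: sgr_rep_def sum_product)
qed

lemma sgr_rep_conj:
  assumes f: "Poly_Mapping.keys f \<subseteq> carrier S" and ij: "i < m" "j < m"
  shows "sgr_rep \<pi> (sgr_conj S P f) i j = sgr_rep \<pi> f j i"
proof -
  have "sgr_rep \<pi> (sgr_conj S P f) i j = (\<Sum>a\<in>Poly_Mapping.keys f.
      Poly_Mapping.lookup f a * of_int (\<pi> (inv a) $$ (i, j)))"
    unfolding sgr_conj_def sgr_rep_sum
    by (intro sum.cong refl sgr_rep_term) (use f ij in auto)
  also have "\<dots> = sgr_rep \<pi> f j i"
    unfolding sgr_rep_def
  proof (intro sum.cong refl)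
    fix a assume "a \<in> Poly_Mapping.keys f"
    then have "a \<in> carrier S" using f by auto
    then show "Poly_Mapping.lookup f a * of_int (\<pi> (inv a) $$ (i, j))
        = Poly_Mapping.lookup f a * of_int (\<pi> a $$ (j, i))"
      using ij remrep_carrier[of a] by (auto simp: remrep_inv)
  qed
  finally show ?thesis .
qed

lemma keys_sgr_conj:
  assumes "Poly_Mapping.keys f \<subseteq> carrier S"
  shows "Poly_Mapping.keys (sgr_conj S P f) \<subseteq> carrier S"
proof -
  have "Poly_Mapping.keys (sgr_conj S P f) \<subseteq>
      (\<Union>a\<in>Poly_Mapping.keys f. Poly_Mapping.keys (sgr_term S P (Poly_Mapping.lookup f a) (inv a)))"
    unfolding sgr_conj_def by (rule keys_sum)
  also have "\<dots> \<subseteq> carrier S"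
    by (intro UN_least keys_sgr_term) (use assms in auto)
  finally show ?thesis .
qed

end

section \<open>Multiplication by a Hadamard matrix\<close>

lemma monomial_mult_sign_entry:
  assumes A: "A \<in> monomial_mats m"
    and H: "\<And>i j. i < m \<Longrightarrow> j < m \<Longrightarrow> H $$ (i, j) \<in> {1, -1 :: int}"
    and ij: "i < m" "j < m"
  shows "(\<Sum>l<m. A $$ (i, l) * H $$ (l, j)) \<in> {1, -1}"
proof -
  obtain l where l: "l < m" "A $$ (i, l) \<noteq> 0"
    and uniq: "\<And>l'. l' < m \<Longrightarrow> A $$ (i, l') \<noteq> 0 \<Longrightarrow> l' = l"
  proof -
    have "\<exists>!l. l < m \<and> A $$ (i, l) \<noteq> 0"
      using A ij(1) by (simp add: monomial_mats_def)
    then show ?thesis by (elim ex1E) (use that in blast)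
  qed
  have "A $$ (i, l) \<in> {0, 1, -1}"
    using A ij(1) l(1) by (simp add: monomial_mats_def)
  moreover have "(\<Sum>l'<m. A $$ (i, l') * H $$ (l', j)) = (\<Sum>l'\<in>{l}. A $$ (i, l') * H $$ (l', j))"
    by (rule sum.mono_neutral_right) (use l in \<open>auto dest: uniq\<close>)
  ultimately show ?thesis using H[OF l(1) ij(2)] l(2) by auto
qed

lemma hadamard_rows:
  assumes "hadamard m H" "i < m" "j < m"
  shows "(\<Sum>l<m. H $$ (i, l) * H $$ (j, l)) = (if i = j then int m else 0)"
proof -
  have "H \<in> carrier_mat m m" and HH: "H * transpose_mat H = int m \<cdot>\<^sub>m 1\<^sub>m m"
    using assms(1) by (auto simp: hadamard_def)
  have "(\<Sum>l<m. H $$ (i, l) * H $$ (j, l)) = (H * transpose_mat H) $$ (i, j)"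
    using \<open>H \<in> carrier_mat m m\<close> assms(2,3) by (simp add: scalar_prod_def lessThan_atLeast0)
  then show ?thesis unfolding HH using assms(2,3) by simp
qed

text \<open>For row vectors this is \<open>(v H) (w H)^T = v (H H^T) w^T = m v w^T\<close>: right
  multiplication by \<open>H\<close> scales all scalar products by \<open>m\<close>.\<close>

lemma hadamard_scalar_prod:
  fixes v w :: "nat \<Rightarrow> 'r::comm_ring_1"
  assumes "hadamard m H"
  shows "(\<Sum>d<m. (\<Sum>c<m. v c * of_int (H $$ (c, d))) * (\<Sum>c<m. w c * of_int (H $$ (c, d))))
    = of_nat m * (\<Sum>c<m. v c * w c)"
proof -
  have "(\<Sum>d<m. (\<Sum>c<m. v c * of_int (H $$ (c, d))) * (\<Sum>c<m. w c * of_int (H $$ (c, d))))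
      = (\<Sum>d<m. \<Sum>c<m. \<Sum>e<m. v c * w e * of_int (H $$ (c, d) * H $$ (e, d)))"
    by (simp add: sum_product ac_simps)
  also have "\<dots> = (\<Sum>c<m. \<Sum>d<m. \<Sum>e<m. v c * w e * of_int (H $$ (c, d) * H $$ (e, d)))"
    by (rule sum.swap)
  also have "\<dots> = (\<Sum>c<m. \<Sum>e<m. \<Sum>d<m. v c * w e * of_int (H $$ (c, d) * H $$ (e, d)))"
    by (intro sum.cong refl sum.swap)
  also have "\<dots> = (\<Sum>c<m. \<Sum>e<m. v c * w e * of_int (\<Sum>d<m. H $$ (c, d) * H $$ (e, d)))"
    by (simp only: of_int_sum sum_distrib_left)
  also have "\<dots> = (\<Sum>c<m. \<Sum>e<m. if c = e then of_nat m * (v c * w e) else 0)"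
    by (intro sum.cong refl) (auto simp: hadamard_rows[OF assms])
  finally show ?thesis by (simp add: sum_distrib_left)
qed

section \<open>The block matrix and its Gram matrix\<close>

theorem theorem4:
  fixes S :: "('a, 'c) signed_group_scheme"
    and P :: "'a set"
    and n m k :: nat
    and u :: "nat \<Rightarrow> nat"
    and \<pi> :: "'a \<Rightarrow> int mat"
  assumes "n > 0" and "m > 0" and "k > 0"
    and "\<And>l. l \<in> {1..k} \<Longrightarrow> u l > 0"
    and "signed_group S"
    and "coset_reps S P"
    and "\<exists>X. SOD S P n k u X"
    and "remrep S m \<pi>"
    and "\<exists>H. hadamard m H"
  shows "\<exists>Y. OD (m * n) k (\<lambda>l. m * u l) Y"
proof -
  interpret signed_group_remrep S m \<pi>
    using assms(5,8) by (simp add: signed_group_remrep_def signed_group_remrep_axioms_def)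
  obtain X where X: "X \<in> carrier_mat n n"
    and entries: "\<And>i j. i < n \<Longrightarrow> j < n \<Longrightarrow> X $$ (i, j) = 0 \<or>
        (\<exists>\<epsilon> \<in> carrier S. \<exists>l \<in> {1..k}. X $$ (i, j) = sgr_term S P (indet l) \<epsilon>)"
    and XX: "sgr_mat_mult S P X (sgr_mat_star S P X) =
       sgr_scalar_mat S P n (\<Sum>l = 1..k. of_nat (u l) * (indet l)^2)"
    using assms(7) unfolding SOD_def by blast
  obtain H where H: "hadamard m H" using assms(9) by blast
  then have H_sign: "\<And>i j. i < m \<Longrightarrow> j < m \<Longrightarrow> H $$ (i, j) \<in> {1, -1}"
    by (simp add: hadamard_def)
  let ?q = "\<Sum>l = 1..k. of_nat (u l) * (indet l)^2"
  have keys: "Poly_Mapping.keys (X $$ (i, j)) \<subseteq> carrier S" if "i < n" "j < n" for i j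
    using entries[OF that] keys_sgr_term by (elim disjE bexE) simp_all
  \<comment> \<open>Applying \<Phi> to the SOD identity gives block row orthogonality before
    \<open>H\<close> enters: the left side is the entry \<open>(a, b)\<close> of block
    \<open>(i, j)\<close> of \<Phi>\<open>(X)\<close> times its transpose.\<close>
  have rows: "(\<Sum>l<n. \<Sum>c<m. sgr_rep \<pi> (X $$ (i, l)) a c * sgr_rep \<pi> (X $$ (j, l)) b c)
      = (if i = j \<and> a = b then ?q else 0)"
    if "i < n" "j < n" "a < m" "b < m" for i j a b
  proof -
    have "(\<Sum>l<n. sgr_mult S P (X $$ (i, l)) (sgr_conj S P (X $$ (j, l))))
        = sgr_mat_mult S P X (sgr_mat_star S P X) $$ (i, j)"
      using X that by (simp add: sgr_mat_mult_def sgr_mat_star_def)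
    also have "\<dots> = (if i = j then sgr_term S P ?q \<one>\<^bsub>S\<^esub> else 0)"
      unfolding XX using that by (simp add: sgr_scalar_mat_def)
    finally have "sgr_rep \<pi> (\<Sum>l<n. sgr_mult S P (X $$ (i, l)) (sgr_conj S P (X $$ (j, l)))) a b
        = sgr_rep \<pi> (if i = j then sgr_term S P ?q \<one>\<^bsub>S\<^esub> else 0) a b" by simp
    also have "\<dots> = (if i = j \<and> a = b then ?q else 0)"
      using that by (simp add: sgr_rep_term remrep_one)
    finally show ?thesis
      using that by (simp add: sgr_rep_sum sgr_rep_mult sgr_rep_conj keys keys_sgr_conj)
  qed
  \<comment> \<open>\<open>B x\<close> is the block \<Phi>\<open>(x) H\<close>. In \<open>A\<close>,
    an index splits into its block number \<open>div m\<close> and its position \<open>mod m\<close>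
    inside the block.\<close>
  define B :: "_ \<Rightarrow> nat \<Rightarrow> nat \<Rightarrow> real_mpoly"
    where "B x a b = (\<Sum>c<m. sgr_rep \<pi> x a c * of_int (H $$ (c, b)))" for x a b
  define A where "A = mat (m * n) (m * n) (\<lambda>(i, j). B (X $$ (i div m, j div m)) (i mod m) (j mod m))"
  have div_bound: "i div m < n" and mod_bound: "i mod m < m" if "i < m * n" for i
    using that assms(2) by (simp_all add: less_mult_imp_div_less mult.commute)
  have A_entry: "A $$ (i, j) = 0 \<or> (\<exists>l \<in> {1..k}. A $$ (i, j) = indet l \<or> A $$ (i, j) = - indet l)"
    if ij: "i < m * n" "j < m * n" for i j
  proof -
    have Aij: "A $$ (i, j) = B (X $$ (i div m, j div m)) (i mod m) (j mod m)"
      using ij by (simp add: A_def)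
    consider "X $$ (i div m, j div m) = 0"
      | \<epsilon> l where "\<epsilon> \<in> carrier S" "l \<in> {1..k}" "X $$ (i div m, j div m) = sgr_term S P (indet l) \<epsilon>"
      using entries[OF div_bound[OF ij(1)] div_bound[OF ij(2)]] by blast
    then show ?thesis
    proof cases
      case 1
      then show ?thesis by (simp add: Aij B_def)
    next
      case 2
      have "A $$ (i, j) = indet l * of_int (\<Sum>c<m. \<pi> \<epsilon> $$ (i mod m, c) * H $$ (c, j mod m))"
        using mod_bound[OF ij(1)]
        by (simp add: Aij B_def 2(1,3) sgr_rep_term sum_distrib_left mult.assoc)
      moreover have "(\<Sum>c<m. \<pi> \<epsilon> $$ (i mod m, c) * H $$ (c, j mod m)) \<in> {1, -1}"
        by (rule monomial_mult_sign_entry[OF remrep_monomial[OF 2(1)] H_sign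
              mod_bound[OF ij(1)] mod_bound[OF ij(2)]])
      \<comment> \<open>The sum has to stay a single integer under \<open>of_int\<close>, so that
        its value 1 or -1 can be substituted.\<close>
      ultimately show ?thesis using 2(2) by (auto simp del: of_int_sum of_int_mult)
    qed
  qed
  have "A * transpose_mat A = (\<Sum>l = 1..k. of_nat (m * u l) * (indet l)^2) \<cdot>\<^sub>m 1\<^sub>m (m * n)"
  proof (rule eq_matI)
    fix i j
    assume "i < dim_row ((\<Sum>l = 1..k. of_nat (m * u l) * (indet l)^2) \<cdot>\<^sub>m 1\<^sub>m (m * n) :: real_mpoly mat)"
      and "j < dim_col ((\<Sum>l = 1..k. of_nat (m * u l) * (indet l)^2) \<cdot>\<^sub>m 1\<^sub>m (m * n) :: real_mpoly mat)"
    then have ij: "i < m * n" "j < m * n" by auto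
    let ?i = "i div m" and ?a = "i mod m" and ?j = "j div m" and ?b = "j mod m"
    have "(A * transpose_mat A) $$ (i, j)
        = (\<Sum>h<n * m. B (X $$ (?i, h div m)) ?a (h mod m) * B (X $$ (?j, h div m)) ?b (h mod m))"
      using ij by (simp add: A_def scalar_prod_def lessThan_atLeast0 mult.commute[of n])
    \<comment> \<open>Columns are grouped by block, block \<open>l\<close> starting at
      \<open>l * m\<close>. The form \<open>0 + l * m\<close> of the lower bound matches the index
      shift that follows.\<close>
    also have "\<dots> = (\<Sum>l<n. \<Sum>h=0 + l * m..<m + l * m.
        B (X $$ (?i, h div m)) ?a (h mod m) * B (X $$ (?j, h div m)) ?b (h mod m))"
      by (simp only: sum.nat_group[symmetric] add.commute[of m] add_0)
    also have "\<dots> = (\<Sum>l<n. \<Sum>d<m. B (X $$ (?i, l)) ?a d * B (X $$ (?j, l)) ?b d)"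
      by (simp only: sum.shift_bounds_nat_ivl) (simp add: lessThan_atLeast0)
    \<comment> \<open>Within each block column \<open>H\<close> disappears and leaves the factor
      \<open>m\<close>; what remains is the sum evaluated in \<open>rows\<close>.\<close>
    also have "\<dots> = (\<Sum>l<n. of_nat m *
        (\<Sum>c<m. sgr_rep \<pi> (X $$ (?i, l)) ?a c * sgr_rep \<pi> (X $$ (?j, l)) ?b c))"
      unfolding B_def by (simp only: hadamard_scalar_prod[OF H])
    also have "\<dots> = of_nat m * (if ?i = ?j \<and> ?a = ?b then ?q else 0)"
      unfolding sum_distrib_left[symmetric]
      by (simp only: rows div_bound[OF ij(1)] div_bound[OF ij(2)] mod_bound[OF ij(1)] mod_bound[OF ij(2)])
    also have "?i = ?j \<and> ?a = ?b \<longleftrightarrow> i = j"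
      by (metis div_mult_mod_eq)
    finally show "(A * transpose_mat A) $$ (i, j)
        = ((\<Sum>l = 1..k. of_nat (m * u l) * (indet l)^2) \<cdot>\<^sub>m 1\<^sub>m (m * n)) $$ (i, j)"
      using ij by (simp add: sum_distrib_left mult.assoc)
  qed (simp_all add: A_def)
  moreover have "A \<in> carrier_mat (m * n) (m * n)" by (simp add: A_def)
  \<comment> \<open>\<open>OD_iff\<close> turns the polynomial matrix \<open>A\<close> into a design
    over the trivial signed group.\<close>
  ultimately show ?thesis using A_entry by (subst OD_iff) blast
qed

end
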